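(* There are universal constants $c_1,c_2>0$ such that the following holds. Let $\mathcal{G}_0,\mathcal{G}_1,\mathcal{R},\epsilon>0$ satisfy $$\epsilon\le\frac{\mathcal{G}_0}{\mathcal{G}_1}\exp\big(\tfrac18\mathcal{R}\mathcal{G}_1\big),\qquad\mathcal{R}\mathcal{G}_1\ge8,$$ and let $\eta>0$ be an arbitrary stepsize. Then there exist a convex function $f\colon\mathbb{R}^d\to\mathbb{R}$ having a global minimizer $x^*$ with $\|x^*\|\le\mathcal{R}$ (put $f^*=f(x^* )$), and a corresponding stochastic gradient oracle $\nabla_\xi f\colon\mathbb{R}^d\to\mathbb{R}^d$ satisfying the $(\mathcal{G}_0,\mathcal{G}_1)$ stochastic generalized Lipschitz condition (see context), such that for the iterates $x_0=0$, $x_{k+1}=\mathrm{proj}_{Q_{\mathcal{R}}}\big(x_k-\eta\nabla_{\xi_k}f(x_k)\big)$ with independent $\xi_k\sim\mathcal{D}$, and $\overline{x}_K=\frac{1}{K+1}\sum_{k=0}^Kx_k$, every $K$ with $$\mathbb{E}\big[\min\{f(x_K),f(\overline{x}_K)\}-f^*\big]\le\epsilon$$ satisfies $$K\ge c_1\exp(c_2\mathcal{R}\mathcal{G}_1)\cdot\frac{\mathcal{R}\mathcal{G}_0}{\epsilon}.$$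
   Context: $\|\cdot\|$ is the Euclidean norm; $Q_{\mathcal{R}}=\{x\in\mathbb{R}^d:\|x\|\le\mathcal{R}\}$; $\mathrm{proj}_{Q_{\mathcal R}}$ is the Euclidean projection onto $Q_{\mathcal R}$; $\nabla f(x)\in\partial f(x)$ denotes a subgradient of $f$ at $x$. $(\mathcal{G}_0,\mathcal{G}_1)$ stochastic generalized Lipschitz condition: the estimator $\nabla_\xi f(x)$, $\xi\sim\mathcal{D}$, satisfies $\mathbb{E}_{\xi\sim\mathcal{D}}[\nabla_\xi f(x)]=\nabla f(x)$ for all $x$, and admits a decomposition $\nabla_\xi f(x)=u_\xi(x)+v_\xi(x)$ such that for all $x$: $\mathbb{E}_{\xi\sim\mathcal{D}}\|u_\xi(x)\|^2\le\mathcal{G}_0^2$ and $\|v_\xi(x)\|\le\mathcal{G}_1[f(x)-f^*]$ almost surely. *)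

theory Defs
  imports "HOL-Probability.Probability"
begin

text \<open>
  The constants of the theorem are to be universal, i.e. independent of the dimension \<open>d\<close>, so \<open>d\<close>
  has to be a bound natural number and cannot be a type. As in the library's
  \<^const>\<open>Euclidean_space\<close>, a vector of dimension \<open>d\<close> is a function \<open>nat \<Rightarrow> real\<close> vanishing at all
  indices \<open>i \<ge> d\<close>. Only the values of functions on this carrier matter. On the carrier, the borel
  sigma algebra of \<open>nat \<Rightarrow> real\<close> (product topology) restricts to the usual one.
\<close>

type_synonym vect = "nat \<Rightarrow> real"

abbreviation Rd :: "nat \<Rightarrow> vect set" where
  "Rd d \<equiv> topspace (Euclidean_space d)"

definition enorm :: "nat \<Rightarrow> vect \<Rightarrow> real" where
  "enorm d x = L2_set x {..<d}"

definition einner :: "nat \<Rightarrow> vect \<Rightarrow> vect \<Rightarrow> real" where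
  "einner d x y = (\<Sum>i<d. x i * y i)"

definition ball_Q :: "nat \<Rightarrow> real \<Rightarrow> vect set" where
  "ball_Q d R = {x \<in> Rd d. enorm d x \<le> R}"

text \<open>Analogue of \<^const>\<open>closest_point\<close>.\<close>

definition eproj :: "nat \<Rightarrow> vect set \<Rightarrow> vect \<Rightarrow> vect" where
  "eproj d S a =
    (SOME x. x \<in> S \<and> (\<forall>y\<in>S. enorm d (\<lambda>i. a i - x i) \<le> enorm d (\<lambda>i. a i - y i)))"

definition convex_Rd :: "nat \<Rightarrow> (vect \<Rightarrow> real) \<Rightarrow> bool" where
  "convex_Rd d f \<longleftrightarrow>
    (\<forall>x\<in>Rd d. \<forall>y\<in>Rd d. \<forall>t\<in>{0..1}.
       f (\<lambda>i. (1 - t) * x i + t * y i) \<le> (1 - t) * f x + t * f y)"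

definition subdifferential :: "nat \<Rightarrow> (vect \<Rightarrow> real) \<Rightarrow> vect \<Rightarrow> vect set" where
  "subdifferential d f x =
    {s \<in> Rd d. \<forall>y\<in>Rd d. f y \<ge> f x + einner d s (\<lambda>i. y i - x i)}"

definition global_minimizer :: "nat \<Rightarrow> (vect \<Rightarrow> real) \<Rightarrow> vect \<Rightarrow> bool" where
  "global_minimizer d f z \<longleftrightarrow> z \<in> Rd d \<and> (\<forall>y\<in>Rd d. f z \<le> f y)"

text \<open>
  A stochastic oracle \<open>g\<close> maps a noise value \<open>\<xi>\<close> and a point \<open>x\<close> to the estimator at \<open>x\<close>.
  Joint measurability makes the iterates random variables.
\<close>

definition stoch_oracle :: "nat \<Rightarrow> 'z measure \<Rightarrow> ('z \<Rightarrow> vect \<Rightarrow> vect) \<Rightarrow> bool" where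
  "stoch_oracle d D g \<longleftrightarrow>
    (\<forall>\<xi>\<in>space D. \<forall>x\<in>Rd d. g \<xi> x \<in> Rd d) \<and>
    (\<lambda>(\<xi>, x). g \<xi> x) \<in> borel_measurable (D \<Otimes>\<^sub>M restrict_space borel (Rd d))"

text \<open>The expectation of the estimator is taken coordinatewise; \<open>gradf\<close> is the selected subgradient
  and \<open>fstar\<close> the minimal value of \<open>f\<close>.\<close>

definition stoch_gen_lipschitz ::
  "nat \<Rightarrow> real \<Rightarrow> real \<Rightarrow> (vect \<Rightarrow> real) \<Rightarrow> real \<Rightarrow> (vect \<Rightarrow> vect) \<Rightarrow>
   'z measure \<Rightarrow> ('z \<Rightarrow> vect \<Rightarrow> vect) \<Rightarrow> bool" where
  "stoch_gen_lipschitz d G0 G1 f fstar gradf D g \<longleftrightarrow>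
    (\<forall>x\<in>Rd d. \<forall>i<d. integrable D (\<lambda>\<xi>. g \<xi> x i) \<and> (\<integral>\<xi>. g \<xi> x i \<partial>D) = gradf x i) \<and>
    (\<exists>u v. \<forall>x\<in>Rd d.
       (\<lambda>\<xi>. u \<xi> x) \<in> borel_measurable D \<and> (\<lambda>\<xi>. v \<xi> x) \<in> borel_measurable D \<and>
       (\<forall>\<xi>\<in>space D. u \<xi> x \<in> Rd d \<and> v \<xi> x \<in> Rd d \<and> g \<xi> x = (\<lambda>i. u \<xi> x i + v \<xi> x i)) \<and>
       integrable D (\<lambda>\<xi>. (enorm d (u \<xi> x))\<^sup>2) \<and>
       (\<integral>\<xi>. (enorm d (u \<xi> x))\<^sup>2 \<partial>D) \<le> G0\<^sup>2 \<and>
       (AE \<xi> in D. enorm d (v \<xi> x) \<le> G1 * (f x - fstar)))"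

text \<open>Iterates along a noise sequence \<open>\<omega>\<close>.\<close>

primrec psgd ::
  "nat \<Rightarrow> real \<Rightarrow> real \<Rightarrow> ('z \<Rightarrow> vect \<Rightarrow> vect) \<Rightarrow> (nat \<Rightarrow> 'z) \<Rightarrow> nat \<Rightarrow> vect" where
  "psgd d R \<eta> g \<omega> 0 = (\<lambda>i. 0)"
| "psgd d R \<eta> g \<omega> (Suc k) =
    eproj d (ball_Q d R) (\<lambda>i. psgd d R \<eta> g \<omega> k i - \<eta> * g (\<omega> k) (psgd d R \<eta> g \<omega> k) i)"

definition psgd_avg ::
  "nat \<Rightarrow> real \<Rightarrow> real \<Rightarrow> ('z \<Rightarrow> vect \<Rightarrow> vect) \<Rightarrow> (nat \<Rightarrow> 'z) \<Rightarrow> nat \<Rightarrow> vect" where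
  "psgd_avg d R \<eta> g \<omega> K = (\<lambda>i. 1 / (real K + 1) * (\<Sum>k\<le>K. psgd d R \<eta> g \<omega> k i))"

text \<open>Independent samples from \<open>D\<close> are the coordinates of the infinite product space.\<close>

definition expected_gap ::
  "nat \<Rightarrow> real \<Rightarrow> real \<Rightarrow> (vect \<Rightarrow> real) \<Rightarrow> real \<Rightarrow> 'z measure \<Rightarrow> ('z \<Rightarrow> vect \<Rightarrow> vect) \<Rightarrow> nat \<Rightarrow> real"
where
  "expected_gap d R \<eta> f fstar D g K =
    (\<integral>\<omega>. min (f (psgd d R \<eta> g \<omega> K)) (f (psgd_avg d R \<eta> g \<omega> K)) - fstar
       \<partial>(\<Pi>\<^sub>M k\<in>(UNIV :: nat set). D))"

end

theory Submission
  imports Defs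
begin

text \<open>
  A deterministic oracle in one dimension suffices, with
  \<open>f t = a (exp (G1 \<bar>t - m\<bar>) - 1)\<close> and \<open>a G1 \<le> G0\<close>, for which \<open>\<bar>f'\<bar> = a G1 + G1 f\<close>.
  If \<open>\<eta> G0 \<ge> 2 R exp (- R G1 / 4)\<close>, take \<open>a = G0 / G1\<close> and \<open>m = 3 R / 4\<close>: all steps overshoot, so that
  the iterates alternate between \<open>R\<close> and \<open>-R\<close>, and neither they nor their averages come within
  \<open>R / 4\<close> of \<open>m\<close>. If \<open>\<eta>\<close> is smaller, take \<open>m = R\<close> and \<open>a\<close> such that \<open>f 0 = 2 \<epsilon>\<close>: the slopes on
  \<open>[0, R]\<close> are at most \<open>3 G1 \<epsilon>\<close>, so reaching gap \<open>\<epsilon>\<close> requires moving by \<open>1 / (3 G1)\<close> in steps of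
  length at most \<open>3 \<eta> G1 \<epsilon>\<close>.
\<close>

section \<open>The scalar model and its embedding along the first axis\<close>

definition axis_pt :: "real \<Rightarrow> vect" where
  "axis_pt t = (\<lambda>i. if i = 0 then t else 0)"

definition clamp_real :: "real \<Rightarrow> real \<Rightarrow> real" where
  "clamp_real R t = max (- R) (min R t)"

definition exp_valley :: "real \<Rightarrow> real \<Rightarrow> real \<Rightarrow> real \<Rightarrow> real" where
  "exp_valley a b m t = a * (exp (b * \<bar>t - m\<bar>) - 1)"

text \<open>Since \<open>sgn 0 = 0\<close>, the zero subgradient is selected at the kink
  \<open>t = m\<close>.\<close>

definition exp_valley_slope :: "real \<Rightarrow> real \<Rightarrow> real \<Rightarrow> real \<Rightarrow> real" where
  "exp_valley_slope a b m t = a * b * sgn (t - m) * exp (b * \<bar>t - m\<bar>)"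

primrec real_pgd :: "real \<Rightarrow> real \<Rightarrow> (real \<Rightarrow> real) \<Rightarrow> nat \<Rightarrow> real" where
  "real_pgd R \<eta> h 0 = 0"
| "real_pgd R \<eta> h (Suc k) = clamp_real R (real_pgd R \<eta> h k - \<eta> * h (real_pgd R \<eta> h k))"

lemma mem_Rd_iff: "x \<in> Rd d \<longleftrightarrow> (\<forall>i\<ge>d. x i = 0)"
  by (simp add: topspace_Euclidean_space)

lemma axis_pt_0 [simp]: "axis_pt t 0 = t"
  by (simp add: axis_pt_def)

lemma axis_pt_in_Rd: "d \<ge> 1 \<Longrightarrow> axis_pt t \<in> Rd d"
  by (auto simp: mem_Rd_iff axis_pt_def)

lemma enorm_axis_pt:
  assumes "d \<ge> 1" shows "enorm d (axis_pt t) = \<bar>t\<bar>"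
proof -
  have "(\<Sum>i<d. (axis_pt t i)\<^sup>2) = (\<Sum>i<d. if i = 0 then t\<^sup>2 else 0)"
    by (intro sum.cong) (auto simp: axis_pt_def)
  also have "\<dots> = t\<^sup>2" using assms by simp
  finally show ?thesis by (simp add: enorm_def L2_set_def)
qed

lemma einner_axis_pt:
  assumes "d \<ge> 1" shows "einner d (axis_pt t) y = t * y 0"
proof -
  have "(\<Sum>i<d. axis_pt t i * y i) = (\<Sum>i<d. if i = 0 then t * y 0 else 0)"
    by (intro sum.cong) (auto simp: axis_pt_def)
  then show ?thesis using assms by (simp add: einner_def)
qed

lemma enorm_sq_split:
  assumes "d \<ge> 1"
  shows "(enorm d x)\<^sup>2 = (x 0)\<^sup>2 + (\<Sum>i\<in>{1..<d}. (x i)\<^sup>2)"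
proof -
  have "{..<d} = insert 0 {1..<d}" using assms by auto
  then show ?thesis by (simp add: enorm_def L2_set_def sum_nonneg)
qed

lemma clamp_real_bounds: "R \<ge> 0 \<Longrightarrow> \<bar>clamp_real R t\<bar> \<le> R"
  by (auto simp: clamp_real_def max_def min_def)

lemma clamp_real_dist_le:
  assumes "\<bar>s\<bar> \<le> R"
  shows "\<bar>t - clamp_real R t\<bar> \<le> \<bar>t - s\<bar>"
  using assms by (auto simp: clamp_real_def max_def min_def)

lemma clamp_real_unique:
  assumes "\<bar>s\<bar> \<le> R" "\<bar>t - s\<bar> \<le> \<bar>t - clamp_real R t\<bar>"
  shows "s = clamp_real R t"
  using assms by (auto simp: clamp_real_def max_def min_def split: if_splits)

text \<open>\<open>eproj\<close> is a choice, so the minimizer must be shown to be unique. As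
  \<open>\<bar>x 0\<bar> \<le> enorm d x\<close>, clamping the first coordinate is optimal, and
  equality leaves no room for the other coordinates.\<close>

lemma eproj_axis_pt:
  assumes d: "d \<ge> 1" and R: "R \<ge> 0"
  shows "eproj d (ball_Q d R) (axis_pt t) = axis_pt (clamp_real R t)"
  unfolding eproj_def
proof (rule some_equality)
  let ?c = "clamp_real R t"
  have diff: "(\<lambda>i. axis_pt t i - axis_pt ?c i) = axis_pt (t - ?c)"
    by (auto simp: axis_pt_def)
  have coord: "\<bar>x 0\<bar> \<le> enorm d x" for x
    using member_le_L2_set[of "{..<d}" 0 "\<lambda>i. \<bar>x i\<bar>"] d by (simp add: enorm_def L2_set_def)
  show "axis_pt ?c \<in> ball_Q d R \<and>
    (\<forall>y\<in>ball_Q d R. enorm d (\<lambda>i. axis_pt t i - axis_pt ?c i) \<le> enorm d (\<lambda>i. axis_pt t i - y i))"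
  proof (intro conjI ballI)
    show "axis_pt ?c \<in> ball_Q d R"
      unfolding ball_Q_def using axis_pt_in_Rd[OF d] clamp_real_bounds[OF R]
      by (simp add: enorm_axis_pt[OF d])
    fix y assume "y \<in> ball_Q d R"
    then have "\<bar>y 0\<bar> \<le> R" using coord[of y] by (simp add: ball_Q_def)
    then have "\<bar>t - ?c\<bar> \<le> \<bar>t - y 0\<bar>" by (rule clamp_real_dist_le)
    also have "\<dots> \<le> enorm d (\<lambda>i. axis_pt t i - y i)"
      using coord[of "\<lambda>i. axis_pt t i - y i"] by simp
    finally show "enorm d (\<lambda>i. axis_pt t i - axis_pt ?c i) \<le> enorm d (\<lambda>i. axis_pt t i - y i)"
      by (simp add: diff enorm_axis_pt[OF d])
  qed
  fix x
  assume x: "x \<in> ball_Q d R \<and>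
    (\<forall>y\<in>ball_Q d R. enorm d (\<lambda>i. axis_pt t i - x i) \<le> enorm d (\<lambda>i. axis_pt t i - y i))"
  have "axis_pt ?c \<in> ball_Q d R"
    unfolding ball_Q_def using axis_pt_in_Rd[OF d] clamp_real_bounds[OF R]
    by (simp add: enorm_axis_pt[OF d])
  with x have le: "enorm d (\<lambda>i. axis_pt t i - x i) \<le> \<bar>t - ?c\<bar>"
    using diff enorm_axis_pt[OF d] by metis
  have x0R: "\<bar>x 0\<bar> \<le> R" using coord[of x] x by (simp add: ball_Q_def)
  have "\<bar>t - x 0\<bar> \<le> \<bar>t - ?c\<bar>"
    using coord[of "\<lambda>i. axis_pt t i - x i"] le by simp
  then have x0: "x 0 = ?c" by (rule clamp_real_unique[OF x0R])
  \<comment> \<open>The first coordinate alone already accounts for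
    \<open>\<bar>t - ?c\<bar>\<close>; splitting it off by Pythagoras forces the remaining squares
    to vanish.\<close>
  have "(enorm d (\<lambda>i. axis_pt t i - x i))\<^sup>2 \<le> \<bar>t - ?c\<bar>\<^sup>2"
    by (rule power_mono[OF le]) (simp add: enorm_def L2_set_nonneg)
  then have "(\<Sum>i\<in>{1..<d}. (axis_pt t i - x i)\<^sup>2) \<le> 0"
    by (simp add: enorm_sq_split[OF d] x0)
  then have "(\<Sum>i\<in>{1..<d}. (axis_pt t i - x i)\<^sup>2) = 0"
    by (intro antisym sum_nonneg) auto
  then have "\<forall>i\<in>{1..<d}. x i = 0"
    by (subst (asm) sum_nonneg_eq_0_iff) (auto simp: axis_pt_def)
  moreover have "\<forall>i\<ge>d. x i = 0" using x by (simp add: ball_Q_def mem_Rd_iff)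
  ultimately show "x = axis_pt ?c"
    using x0 by (intro ext) (auto simp: axis_pt_def not_less)
qed

text \<open>The start lies on the axis, and oracle steps and projection both preserve it.\<close>

lemma psgd_axis:
  assumes "d \<ge> 1" "R \<ge> 0"
  shows "psgd d R \<eta> (\<lambda>\<xi> x. axis_pt (h (x 0))) \<omega> k = axis_pt (real_pgd R \<eta> h k)"
proof (induction k)
  case 0
  show ?case by (auto simp: axis_pt_def)
next
  case (Suc k)
  have "(\<lambda>i. axis_pt s i - \<eta> * axis_pt r i) = axis_pt (s - \<eta> * r)" for s r
    by (auto simp: axis_pt_def)
  with Suc show ?case by (simp add: eproj_axis_pt[OF assms])
qed

section \<open>Convexity of the exponential valley\<close>

lemma exp_valley_subgradient:
  assumes "a \<ge> 0" "b \<ge> 0"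
  shows "exp_valley a b m y \<ge> exp_valley a b m x + exp_valley_slope a b m x * (y - x)"
proof -
  let ?p = "b * \<bar>y - m\<bar>" and ?q = "b * \<bar>x - m\<bar>"
  \<comment> \<open>The subgradient inequality of the absolute value; it is passed through the
    exponential by \<open>1 + s \<le> exp s\<close>, scaled by \<open>exp ?q\<close>.\<close>
  have "\<bar>y - m\<bar> - \<bar>x - m\<bar> \<ge> sgn (x - m) * (y - x)"
    by (auto simp: sgn_if)
  then have "b * (\<bar>y - m\<bar> - \<bar>x - m\<bar>) \<ge> b * (sgn (x - m) * (y - x))"
    by (rule mult_left_mono[OF _ assms(2)])
  then have "1 + b * (sgn (x - m) * (y - x)) \<le> 1 + (?p - ?q)"
    by (simp add: algebra_simps)
  also have "\<dots> \<le> exp (?p - ?q)" by (rule exp_ge_add_one_self)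
  finally have "exp ?q * (1 + b * (sgn (x - m) * (y - x))) \<le> exp ?q * exp (?p - ?q)"
    by (intro mult_left_mono) auto
  also have "\<dots> = exp ?p" by (simp flip: exp_add)
  finally have "a * (exp ?q * (1 + b * (sgn (x - m) * (y - x)))) \<le> a * exp ?p"
    by (rule mult_left_mono[OF _ assms(1)])
  then show ?thesis by (simp add: exp_valley_def exp_valley_slope_def algebra_simps)
qed

lemma exp_valley_nonneg:
  "a \<ge> 0 \<Longrightarrow> b \<ge> 0 \<Longrightarrow> exp_valley a b m t \<ge> 0"
  by (simp add: exp_valley_def)

text \<open>The subgradient inequality at the intermediate point is applied to both endpoints; in
  the weighted sum the linear terms cancel.\<close>

lemma convex_Rd_if_subgradients:
  assumes "\<forall>x\<in>Rd d. gradf x \<in> subdifferential d f x"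
  shows "convex_Rd d f"
  unfolding convex_Rd_def
proof (intro ballI)
  fix x y and t :: real
  assume x: "x \<in> Rd d" and y: "y \<in> Rd d" and t: "t \<in> {0..1}"
  let ?z = "\<lambda>i. (1 - t) * x i + t * y i"
  have z: "?z \<in> Rd d" using x y by (simp add: mem_Rd_iff)
  let ?e = "\<lambda>w. einner d (gradf ?z) (\<lambda>i. w i - ?z i)"
  have sub: "f w \<ge> f ?z + ?e w" if "w \<in> Rd d" for w
    using assms z that by (auto simp: subdifferential_def)
  have "(1 - t) * ?e x + t * ?e y = 0"
    unfolding einner_def sum_distrib_left sum.distrib[symmetric]
    by (intro sum.neutral) (simp add: algebra_simps)
  moreover have "(1 - t) * (f ?z + ?e x) + t * (f ?z + ?e y) \<le> (1 - t) * f x + t * f y"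
    using t by (intro add_mono mult_left_mono sub x y) auto
  ultimately show "f ?z \<le> (1 - t) * f x + t * f y" by (simp add: algebra_simps)
qed

section \<open>The oracle and its expected gap\<close>

lemma axis_pt_measurable:
  "h \<in> borel_measurable M \<Longrightarrow> (\<lambda>x. axis_pt (h x)) \<in> borel_measurable M"
  by (rule measurable_coordinatewise_then_product) (simp add: axis_pt_def)

lemma exp_valley_slope_measurable [measurable]: "exp_valley_slope a b m \<in> borel_measurable borel"
  unfolding exp_valley_slope_def by measurable

lemma stoch_oracle_axis:
  assumes d: "d \<ge> 1" and [measurable]: "h \<in> borel_measurable borel"
  shows "stoch_oracle d D (\<lambda>\<xi> x. axis_pt (h (x 0)))"
proof -
  have [measurable]: "(\<lambda>x::vect. x 0) \<in> borel_measurable (restrict_space borel (Rd d))"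
    by (intro measurable_restrict_space1 measurable_product_coordinates)
  have "(\<lambda>p. axis_pt (h (snd p 0))) \<in> borel_measurable (D \<Otimes>\<^sub>M restrict_space borel (Rd d))"
    by (intro axis_pt_measurable) measurable
  then show ?thesis
    using axis_pt_in_Rd[OF d] by (simp add: stoch_oracle_def case_prod_unfold)
qed

text \<open>Writing \<open>exp = 1 + (exp - 1)\<close> splits the slope into \<open>u\<close>, of
  size at most \<open>a * b\<close>, and \<open>v\<close>, of size at most \<open>b\<close> times
  the gap; the minimal value is 0.\<close>

lemma stoch_gen_lipschitz_exp_valley:
  assumes d: "d \<ge> 1" and ab: "a \<ge> 0" "b \<ge> 0" "a * b \<le> G0" and D: "prob_space D"
  shows "stoch_gen_lipschitz d G0 b (\<lambda>x. exp_valley a b m (x 0)) 0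
    (\<lambda>x. axis_pt (exp_valley_slope a b m (x 0))) D
    (\<lambda>\<xi> x. axis_pt (exp_valley_slope a b m (x 0)))"
proof -
  interpret prob_space D by fact
  define u where "u = (\<lambda>x::vect. a * b * sgn (x 0 - m))"
  define v where "v = (\<lambda>x::vect. b * sgn (x 0 - m) * exp_valley a b m (x 0))"
  have uv: "axis_pt (exp_valley_slope a b m (x 0)) = (\<lambda>i. axis_pt (u x) i + axis_pt (v x) i)" for x
    by (auto simp: axis_pt_def u_def v_def exp_valley_def exp_valley_slope_def algebra_simps)
  have "0 \<le> a * b" using ab by simp
  then have "0 \<le> G0" using ab(3) by linarith
  then have "\<bar>u x\<bar> \<le> G0" for x
    using ab by (auto simp: u_def abs_mult sgn_if)
  then have u: "(u x)\<^sup>2 \<le> G0\<^sup>2" for x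
    by (metis abs_ge_zero power2_abs power_mono)
  have v: "\<bar>v x\<bar> \<le> b * exp_valley a b m (x 0)" for x
    using ab exp_valley_nonneg[OF ab(1,2)] by (simp add: v_def abs_mult sgn_if)
  show ?thesis
    unfolding stoch_gen_lipschitz_def
    by (intro conjI exI[of _ "\<lambda>\<xi> x. axis_pt (u x)"] exI[of _ "\<lambda>\<xi> x. axis_pt (v x)"])
       (use axis_pt_in_Rd[OF d] uv u v in \<open>auto simp: enorm_axis_pt[OF d] prob_space\<close>)
qed

text \<open>The oracle ignores the noise, so the integrand is constant on a probability
  space.\<close>

lemma expected_gap_axis:
  assumes "d \<ge> 1" "R \<ge> 0" "prob_space D"
  shows "expected_gap d R \<eta> (\<lambda>x. f (x 0)) fstar D (\<lambda>\<xi> x. axis_pt (h (x 0))) K =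
    min (f (real_pgd R \<eta> h K)) (f (1 / (real K + 1) * (\<Sum>k\<le>K. real_pgd R \<eta> h k))) - fstar"
proof -
  interpret P: prob_space "\<Pi>\<^sub>M k\<in>(UNIV :: nat set). D"
    by (rule prob_space_PiM) (rule assms(3))
  show ?thesis
    by (simp add: expected_gap_def psgd_avg_def psgd_axis[OF assms(1,2)] P.prob_space)
qed

text \<open>Reduces the theorem to a deterministic statement about scalar iterates; \<open>B\<close>
  stands for the claimed lower bound on \<open>K\<close>.\<close>

lemma exp_valley_instance:
  assumes d: "d \<ge> 1" and ab: "a \<ge> 0" "G1 \<ge> 0" "a * G1 \<le> G0" and m: "0 \<le> m" "m \<le> R"
    and bound: "\<And>K. min (exp_valley a G1 m (real_pgd R \<eta> (exp_valley_slope a G1 m) K))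
       (exp_valley a G1 m
         (1 / (real K + 1) * (\<Sum>k\<le>K. real_pgd R \<eta> (exp_valley_slope a G1 m) k))) \<le> \<epsilon>
       \<Longrightarrow> real K \<ge> B"
  shows "\<exists>(f :: vect \<Rightarrow> real) (xstar :: vect) (gradf :: vect \<Rightarrow> vect)
         (D :: real measure) (g :: real \<Rightarrow> vect \<Rightarrow> vect).
         convex_Rd d f \<and>
         global_minimizer d f xstar \<and> enorm d xstar \<le> R \<and>
         (\<forall>x\<in>Rd d. gradf x \<in> subdifferential d f x) \<and>
         prob_space D \<and> stoch_oracle d D g \<and>
         stoch_gen_lipschitz d G0 G1 f (f xstar) gradf D g \<and>
         (\<forall>K::nat. expected_gap d R \<eta> f (f xstar) D g K \<le> \<epsilon> \<longrightarrow> real K \<ge> B)"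
proof -
  let ?f = "\<lambda>x::vect. exp_valley a G1 m (x 0)"
  let ?s = "\<lambda>x::vect. axis_pt (exp_valley_slope a G1 m (x 0))"
  \<comment> \<open>A point mass serves as the noise distribution.\<close>
  let ?D = "return borel (0::real)"
  have D: "prob_space ?D" by (simp add: prob_space_return)
  have R: "R \<ge> 0" using m by simp
  have min0: "?f (axis_pt m) = 0" by (simp add: exp_valley_def)
  have sub: "\<forall>x\<in>Rd d. ?s x \<in> subdifferential d ?f x"
    using axis_pt_in_Rd[OF d] exp_valley_subgradient[OF ab(1,2)]
    by (auto simp: subdifferential_def einner_axis_pt[OF d])
  have "global_minimizer d ?f (axis_pt m)"
    unfolding global_minimizer_def
    using axis_pt_in_Rd[OF d] exp_valley_nonneg[OF ab(1,2)] min0 by simp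
  moreover have "stoch_gen_lipschitz d G0 G1 ?f (?f (axis_pt m)) ?s ?D (\<lambda>_. ?s)"
    unfolding min0 by (rule stoch_gen_lipschitz_exp_valley[OF d ab D])
  moreover have "\<forall>K. expected_gap d R \<eta> ?f (?f (axis_pt m)) ?D (\<lambda>_. ?s) K \<le> \<epsilon> \<longrightarrow> real K \<ge> B"
    unfolding min0 expected_gap_axis[OF d R D] using bound by simp
  ultimately show ?thesis
    using convex_Rd_if_subgradients[OF sub] sub D m enorm_axis_pt[OF d, of m]
      stoch_oracle_axis[OF d exp_valley_slope_measurable, of ?D a G1 m]
    by (intro exI[of _ ?f] exI[of _ "axis_pt m"] exI[of _ ?s] exI[of _ ?D] exI[of _ "\<lambda>_. ?s"]) auto
qed

section \<open>Large steps: overshooting\<close>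

lemma real_pgd_alternates:
  assumes R: "R > 0" and start: "\<eta> * h 0 \<le> - R" and right: "\<eta> * h R \<ge> 2 * R"
    and left: "\<eta> * h (- R) \<le> - (2 * R)"
  shows "real_pgd R \<eta> h k = (if k = 0 then 0 else if odd k then R else - R)"
proof (induction k)
  case (Suc k)
  \<comment> \<open>From 0 a move of length \<open>R\<close> reaches the boundary, from
    \<open>R\<close> or \<open>-R\<close> a move of length \<open>2 * R\<close> reaches the opposite
    end; clamping removes any excess.\<close>
  then show ?case using assms by (auto simp: clamp_real_def)
qed simp

lemma sum_alternating:
  "(\<Sum>k\<le>(K::nat). if k = 0 then 0 else if odd k then R else - R) = (if odd K then R else (0::real))"
  by (induction K) auto

text \<open>Iterates lie in \<open>{0, R, -R}\<close> and averages in \<open>[0, R / 2]\<close>. The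
  choice \<open>m = 3 * R / 4\<close>, midway between \<open>R / 2\<close> and \<open>R\<close>,
  keeps distance \<open>R / 4\<close> from all of them.\<close>

lemma large_step_gap:
  assumes pos: "G0 > 0" "G1 > 0" "R > 0" and \<epsilon>: "\<epsilon> \<le> G0 / G1 * exp (R * G1 / 8)"
    and RG: "R * G1 \<ge> 8" and \<eta>: "\<eta> * G0 \<ge> 2 * R * exp (- (R * G1 / 4))"
  defines "f \<equiv> exp_valley (G0 / G1) G1 (3 * R / 4)"
    and "x \<equiv> real_pgd R \<eta> (exp_valley_slope (G0 / G1) G1 (3 * R / 4))"
  shows "\<epsilon> < min (f (x K)) (f (1 / (real K + 1) * (\<Sum>k\<le>K. x k)))"
proof -
  let ?h = "exp_valley_slope (G0 / G1) G1 (3 * R / 4)"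
  \<comment> \<open>The slope at distance \<open>r\<close> from \<open>m\<close> has size
    \<open>G0 * exp (G1 * r)\<close>; at \<open>r = R / 4\<close> its exponential cancels the one in
    the stepsize threshold.\<close>
  have step: "\<eta> * (G0 * exp (G1 * r)) \<ge> 2 * R" if "r \<ge> R / 4" for r
  proof -
    have "2 * R = 2 * R * exp (- (R * G1 / 4)) * exp (R * G1 / 4)"
      by (simp add: mult.assoc flip: exp_add)
    also have "\<dots> \<le> (\<eta> * G0) * exp (G1 * r)"
    proof (rule mult_mono[OF \<eta>])
      show "exp (R * G1 / 4) \<le> exp (G1 * r)" using that pos by (simp add: field_simps)
      show "0 \<le> \<eta> * G0" using order_trans[OF _ \<eta>, of 0] pos by simp
    qed simp
    finally show ?thesis by (simp add: mult.assoc)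
  qed
  have x: "x k = (if k = 0 then 0 else if odd k then R else - R)" for k
    unfolding x_def
  proof (rule real_pgd_alternates)
    show "\<eta> * ?h 0 \<le> - R"
      using step[of "3 * R / 4"] pos by (simp add: exp_valley_slope_def)
    show "\<eta> * ?h R \<ge> 2 * R"
      using step[of "R / 4"] pos by (simp add: exp_valley_slope_def)
    show "\<eta> * ?h (- R) \<le> - (2 * R)"
      using step[of "7 * R / 4"] pos by (simp add: exp_valley_slope_def sgn_if)
  qed (use pos in simp)
  have far: "\<epsilon> < f t" if "\<bar>t - 3 * R / 4\<bar> \<ge> R / 4" for t
  proof -
    let ?e = "exp (R * G1 / 8)"
    \<comment> \<open>The value at distance \<open>R / 4\<close> is
      \<open>G0 / G1 * (?e * ?e - 1)\<close>. It exceeds \<open>G0 / G1 * ?e\<close> because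
      \<open>R * G1 \<ge> 8\<close> gives \<open>?e \<ge> 2\<close>.\<close>
    have "2 \<le> ?e" using exp_ge_add_one_self[of "R * G1 / 8"] RG by linarith
    then have "?e + 1 < ?e * ?e"
      using mult_right_mono[of 2 ?e ?e] by linarith
    also have "?e * ?e = exp (G1 * (R / 4))" by (simp add: mult.commute flip: exp_add)
    also have "\<dots> \<le> exp (G1 * \<bar>t - 3 * R / 4\<bar>)" using that pos by simp
    finally have "G0 / G1 * ?e < G0 / G1 * (exp (G1 * \<bar>t - 3 * R / 4\<bar>) - 1)"
      using pos by (intro mult_strict_left_mono) auto
    with \<epsilon> show ?thesis by (simp add: f_def exp_valley_def)
  qed
  have "\<bar>x K - 3 * R / 4\<bar> \<ge> R / 4" using pos by (auto simp: x)
  moreover have "\<bar>1 / (real K + 1) * (\<Sum>k\<le>K. x k) - 3 * R / 4\<bar> \<ge> R / 4"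
  proof (cases "odd K")
    case True
    \<comment> \<open>The average \<open>R / (real K + 1)\<close> is largest at
      \<open>K = 1\<close>, where it equals \<open>R / 2\<close>.\<close>
    then have "real K \<ge> 1" by (cases K) auto
    then have "R / (real K + 1) \<le> R / 2" using pos by (intro divide_left_mono) auto
    moreover have "1 / (real K + 1) * (\<Sum>k\<le>K. x k) = R / (real K + 1)"
      using True by (simp add: x sum_alternating)
    ultimately show ?thesis by linarith
  qed (use pos in \<open>simp add: x sum_alternating\<close>)
  ultimately show ?thesis using far by simp
qed

section \<open>Small steps: slow progress\<close>

lemma real_pgd_drift:
  assumes "R \<ge> 0" "\<eta> \<ge> 0" "L \<ge> 0"
    and h: "\<And>t. 0 \<le> t \<Longrightarrow> t \<le> R \<Longrightarrow> - L \<le> h t \<and> h t \<le> 0"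
  shows "0 \<le> real_pgd R \<eta> h k \<and> real_pgd R \<eta> h k \<le> R \<and> real_pgd R \<eta> h k \<le> real k * (\<eta> * L)"
proof (induction k)
  case (Suc k)
  let ?x = "real_pgd R \<eta> h k"
  \<comment> \<open>Each step moves right by at most \<open>\<eta> * L\<close>, and clamping at
    \<open>R\<close> keeps the iterate where the slope bounds apply.\<close>
  have "- L \<le> h ?x \<and> h ?x \<le> 0" using Suc h by blast
  then have "\<eta> * h ?x \<le> 0" "\<eta> * (- L) \<le> \<eta> * h ?x"
    using assms(2) by (blast intro: mult_nonneg_nonpos mult_left_mono)+
  with Suc \<open>R \<ge> 0\<close> show ?case by (auto simp: clamp_real_def algebra_simps)
qed (use assms in simp)

text \<open>The factor 9 is 3 squared: the slope bound \<open>3 * G1 * \<epsilon>\<close> limits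
  both the length of a step and the decrease of \<open>f\<close> per unit distance.\<close>

lemma small_step_count:
  assumes pos: "G1 > 0" "R > 0" "\<epsilon> > 0" "\<eta> > 0" and RG: "R * G1 \<ge> 8"
  defines "a \<equiv> 2 * \<epsilon> / (exp (R * G1) - 1)"
  defines "f \<equiv> exp_valley a G1 R" and "x \<equiv> real_pgd R \<eta> (exp_valley_slope a G1 R)"
  assumes gap: "min (f (x K)) (f (1 / (real K + 1) * (\<Sum>k\<le>K. x k))) \<le> \<epsilon>"
  shows "real K * (9 * \<eta> * G1\<^sup>2 * \<epsilon>) \<ge> 1"
proof -
  let ?L = "3 * G1 * \<epsilon>" and ?h = "exp_valley_slope a G1 R"
  have E: "exp (R * G1) \<ge> 9" using exp_ge_add_one_self[of "R * G1"] RG by linarith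
  have a: "a > 0" "a \<le> \<epsilon>" and a_eq: "a * (exp (R * G1) - 1) = 2 * \<epsilon>"
    using pos E by (simp_all add: a_def field_simps)
  \<comment> \<open>Here \<open>a * exp (R * G1) = 2 * \<epsilon> + a\<close>, which is the origin
    of the constant 3.\<close>
  have aE: "a * exp (R * G1) \<le> 3 * \<epsilon>" using a_eq a by (simp add: algebra_simps)
  have h: "- ?L \<le> ?h t \<and> ?h t \<le> 0" if "0 \<le> t" "t \<le> R" for t
  proof -
    have "exp (G1 * \<bar>t - R\<bar>) \<le> exp (R * G1)" using that pos by (simp add: mult.commute)
    then have "a * exp (G1 * \<bar>t - R\<bar>) \<le> 3 * \<epsilon>"
      using aE a by (meson mult_left_mono order_trans less_imp_le)
    then have "G1 * (a * exp (G1 * \<bar>t - R\<bar>)) \<le> G1 * (3 * \<epsilon>)"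
      using pos by (intro mult_left_mono) auto
    then show ?thesis
      using that a pos by (auto simp: exp_valley_slope_def sgn_if mult_ac)
  qed
  have drift: "0 \<le> x k \<and> x k \<le> real k * (\<eta> * ?L)" for k
    unfolding x_def using real_pgd_drift[of R \<eta> ?L ?h k] h pos by auto
  have near: "real K * (9 * \<eta> * G1\<^sup>2 * \<epsilon>) \<ge> 1"
    if t: "0 \<le> t" "t \<le> real K * (\<eta> * ?L)" and ft: "f t \<le> \<epsilon>" for t
  proof -
    \<comment> \<open>The tangent at 0 shows that a drop from \<open>2 * \<epsilon>\<close> to
      \<open>\<epsilon>\<close> requires \<open>?L * t \<ge> \<epsilon>\<close>.\<close>
    have "f t \<ge> f 0 + ?h 0 * (t - 0)"
      unfolding f_def using a pos by (intro exp_valley_subgradient) auto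
    moreover have "f 0 = 2 * \<epsilon>" using a_eq pos by (simp add: f_def exp_valley_def mult.commute)
    moreover have "?h 0 * t \<ge> - ?L * t" using h[of 0] t pos by (intro mult_right_mono) auto
    ultimately have "\<epsilon> \<le> ?L * t" using ft by simp
    also have "\<dots> \<le> ?L * (real K * (\<eta> * ?L))" using t pos by (intro mult_left_mono) auto
    also have "\<dots> = \<epsilon> * (real K * (9 * \<eta> * G1\<^sup>2 * \<epsilon>))" by (simp add: power2_eq_square)
    finally show ?thesis using pos by simp
  qed
  \<comment> \<open>The drift bound at \<open>K\<close> dominates all earlier ones, hence also the
    average, so \<open>near\<close> covers both candidates.\<close>
  have "(\<Sum>k\<le>K. x k) \<le> (\<Sum>k\<le>K. real K * (\<eta> * ?L))"
    using drift pos by (intro sum_mono) (auto intro!: order_trans[OF conjunct2[OF drift]] mult_right_mono)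
  then have "1 / (real K + 1) * (\<Sum>k\<le>K. x k) \<le> real K * (\<eta> * ?L)"
    by (simp add: field_simps)
  moreover have "0 \<le> 1 / (real K + 1) * (\<Sum>k\<le>K. x k)"
    using drift by (simp add: sum_nonneg)
  ultimately show ?thesis
    using gap near[of "x K"] near[of "1 / (real K + 1) * (\<Sum>k\<le>K. x k)"] drift[of K]
    by (auto simp: min_le_iff_disj)
qed

text \<open>Inserting the bound on \<open>\<eta>\<close> leaves
  \<open>exp (R * G1 / 4) / (R * G1)\<^sup>2\<close> in the lower bound for \<open>K\<close>. Half
  of the exponent absorbs the square, the other half survives;
  \<open>2304 = 9 * 256\<close>.\<close>

lemma small_step_bound:
  assumes pos: "G0 > 0" "G1 > 0" "R > 0" "\<epsilon> > 0" "\<eta> > 0"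
    and \<eta>: "\<eta> * G0 \<le> 2 * R * exp (- (R * G1 / 4))"
    and K: "real K * (9 * \<eta> * G1\<^sup>2 * \<epsilon>) \<ge> 1"
  shows "real K \<ge> 1 / 2304 * exp (1 / 8 * R * G1) * (R * G0 / \<epsilon>)"
proof -
  define t where "t = R * G1 / 8"
  have t: "t > 0" "R * G1 = 8 * t" using pos by (simp_all add: t_def)
  let ?e = "exp t"
  \<comment> \<open>With \<open>(R * G1)\<^sup>2 = 64 * t\<^sup>2\<close>, this yields the constant
    \<open>256 = 2 * 64 * 2\<close> below.\<close>
  have sq: "t\<^sup>2 \<le> 2 * ?e" using exp_lower_Taylor_quadratic[of t] t by simp
  have "\<eta> * G0 * (?e * ?e) \<le> 2 * R"
  proof -
    have "\<eta> * G0 * (?e * ?e) \<le> 2 * R * exp (- (2 * t)) * (?e * ?e)"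
      using \<eta> t by (intro mult_right_mono) auto
    also have "\<dots> = 2 * R" by (simp add: mult.assoc flip: exp_add)
    finally show ?thesis .
  qed
  then have "R * (\<eta> * G0 * (?e * ?e)) * (G1\<^sup>2) \<le> R * (2 * R) * G1\<^sup>2"
    using pos by (intro mult_right_mono mult_left_mono) auto
  also have "\<dots> = 2 * (R * G1)\<^sup>2" by (simp add: power2_eq_square)
  also have "\<dots> \<le> 256 * ?e" using sq by (simp add: t(2) power_mult_distrib)
  finally have "?e * (R * \<eta> * G0 * ?e * G1\<^sup>2) \<le> ?e * 256" by (simp add: mult_ac)
  then have "R * \<eta> * G0 * ?e * G1\<^sup>2 \<le> 256" by simp
  then have "(R * G0 * ?e) * (9 * \<eta> * G1\<^sup>2 * \<epsilon>) \<le> 2304 * \<epsilon> * 1"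
    using pos by (simp add: mult_ac)
  also have "\<dots> \<le> 2304 * \<epsilon> * (real K * (9 * \<eta> * G1\<^sup>2 * \<epsilon>))"
    using K pos by (intro mult_left_mono) auto
  finally have "(R * G0 * ?e) * (9 * \<eta> * G1\<^sup>2 * \<epsilon>) \<le> (2304 * \<epsilon> * real K) * (9 * \<eta> * G1\<^sup>2 * \<epsilon>)"
    by (simp only: mult.assoc)
  then have "R * G0 * ?e \<le> 2304 * \<epsilon> * real K"
    by (rule mult_right_le_imp_le) (use pos in simp)
  then show ?thesis using pos by (simp add: t_def field_simps)
qed

section \<open>Case distinction on the stepsize\<close>

theorem theorem8:
  shows "\<exists>c1 > (0::real). \<exists>c2 > (0::real).
    \<forall>(d::nat) (G0::real) (G1::real) (R::real) (\<epsilon>::real) (\<eta>::real).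
      d \<ge> 1 \<longrightarrow> G0 > 0 \<longrightarrow> G1 > 0 \<longrightarrow> R > 0 \<longrightarrow> \<epsilon> > 0 \<longrightarrow>
      \<epsilon> \<le> G0 / G1 * exp (1 / 8 * R * G1) \<longrightarrow> R * G1 \<ge> 8 \<longrightarrow> \<eta> > 0 \<longrightarrow>
      (\<exists>(f :: vect \<Rightarrow> real) (xstar :: vect) (gradf :: vect \<Rightarrow> vect)
         (D :: real measure) (g :: real \<Rightarrow> vect \<Rightarrow> vect).
         convex_Rd d f \<and>
         global_minimizer d f xstar \<and> enorm d xstar \<le> R \<and>
         (\<forall>x\<in>Rd d. gradf x \<in> subdifferential d f x) \<and>
         prob_space D \<and> stoch_oracle d D g \<and>
         stoch_gen_lipschitz d G0 G1 f (f xstar) gradf D g \<and>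
         (\<forall>K::nat. expected_gap d R \<eta> f (f xstar) D g K \<le> \<epsilon> \<longrightarrow>
            real K \<ge> c1 * exp (c2 * R * G1) * (R * G0 / \<epsilon>)))"
\<comment> \<open>Both constants come from \<open>small_step_bound\<close>.\<close>
proof (rule exI[of _ "1 / 2304"], rule conjI, simp, rule exI[of _ "1 / 8"], rule conjI, simp,
    intro allI impI)
  fix d :: nat and G0 G1 R \<epsilon> \<eta> :: real
  assume d: "d \<ge> 1" and pos: "G0 > 0" "G1 > 0" "R > 0" "\<epsilon> > 0" "\<eta> > 0"
    and \<epsilon>': "\<epsilon> \<le> G0 / G1 * exp (1 / 8 * R * G1)" and RG: "R * G1 \<ge> 8"
  have \<epsilon>: "\<epsilon> \<le> G0 / G1 * exp (R * G1 / 8)" using \<epsilon>' by simp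
  show "\<exists>(f :: vect \<Rightarrow> real) (xstar :: vect) (gradf :: vect \<Rightarrow> vect)
         (D :: real measure) (g :: real \<Rightarrow> vect \<Rightarrow> vect).
         convex_Rd d f \<and>
         global_minimizer d f xstar \<and> enorm d xstar \<le> R \<and>
         (\<forall>x\<in>Rd d. gradf x \<in> subdifferential d f x) \<and>
         prob_space D \<and> stoch_oracle d D g \<and>
         stoch_gen_lipschitz d G0 G1 f (f xstar) gradf D g \<and>
         (\<forall>K::nat. expected_gap d R \<eta> f (f xstar) D g K \<le> \<epsilon> \<longrightarrow>
            real K \<ge> 1 / 2304 * exp (1 / 8 * R * G1) * (R * G0 / \<epsilon>))"
  proof (cases "\<eta> * G0 \<ge> 2 * R * exp (- (R * G1 / 4))")
    case True
    \<comment> \<open>The gap exceeds \<epsilon> for every \<open>K\<close>, so the bound holds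
      vacuously.\<close>
    show ?thesis
      using large_step_gap[OF pos(1-3) \<epsilon> RG True]
      by (intro exp_valley_instance[OF d, of "G0 / G1" _ _ "3 * R / 4"])
         (use pos in \<open>auto simp: not_le[symmetric]\<close>)
  next
    case False
    let ?e = "exp (R * G1 / 8)" and ?a = "2 * \<epsilon> / (exp (R * G1) - 1)"
    have e2: "?e \<ge> 2" using exp_ge_add_one_self[of "R * G1 / 8"] RG by linarith
    have E: "exp (R * G1) = ?e ^ 8" by (simp flip: exp_of_nat_mult)
    \<comment> \<open>The aim is \<open>?a * G1 \<le> G0\<close>, that is
      \<open>2 * \<epsilon> * G1 \<le> G0 * (exp (R * G1) - 1)\<close>. As
      \<open>\<epsilon> * G1 \<le> G0 * ?e\<close>, it suffices that
      \<open>2 * ?e \<le> ?e ^ 8 - 1\<close>.\<close>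
    have "2 * ?e \<le> ?e ^ 2" using e2 by (simp add: power2_eq_square)
    moreover have "?e ^ 2 * 2 \<le> ?e ^ 2 * ?e ^ 6"
      using power_mono[OF e2, of 6] by (intro mult_left_mono) auto
    moreover have "?e ^ 2 * ?e ^ 6 = ?e ^ 8" by (simp flip: power_add)
    ultimately have "2 * ?e \<le> exp (R * G1) - 1" and E1: "exp (R * G1) - 1 > 0"
      unfolding E using e2 by linarith+
    then have "G0 * (2 * ?e) \<le> G0 * (exp (R * G1) - 1)" using pos by simp
    moreover have "\<epsilon> * G1 \<le> G0 * ?e" using \<epsilon> pos by (simp add: field_simps)
    ultimately have aG: "?a * G1 \<le> G0" using E1 by (simp add: field_simps)
    show ?thesis
    proof (rule exp_valley_instance[OF d _ _ aG, of R])
      show "?a \<ge> 0" using E1 pos by simp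
      show "real K \<ge> 1 / 2304 * exp (1 / 8 * R * G1) * (R * G0 / \<epsilon>)"
        if "min (exp_valley ?a G1 R (real_pgd R \<eta> (exp_valley_slope ?a G1 R) K))
          (exp_valley ?a G1 R
            (1 / (real K + 1) * (\<Sum>k\<le>K. real_pgd R \<eta> (exp_valley_slope ?a G1 R) k))) \<le> \<epsilon>" for K
        using False small_step_count[OF pos(2-5) RG that]
        by (intro small_step_bound[OF pos]) auto
    qed (use pos in auto)
  qed
qed

end
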